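(* Let $Z$ be a Banach space, let $I$ be a directed set, and let $\{Z_i: i\in I\}$ be an increasing family of one-complemented closed subspaces of $Z$ such that $Z=\overline{\bigcup_{i\in I}Z_i}$. Then $$n(Z)\geq\limsup_{i\in I}n(Z_i).$$
   Context: For a Banach space $X$ (real or complex), $S_X$ and $X^*$ denote its unit sphere and dual, and $L(X)$ the bounded linear operators on $X$. Put $\Pi(X)=\{(x,x^* )\in S_X\times S_{X^*}: x^*(x)=1\}$. The numerical radius of $T\in L(X)$ is $v(T)=\sup\{|x^*(Tx)|:(x,x^* )\in\Pi(X)\}$, and the numerical index of $X$ is $n(X)=\inf\{v(T): T\in L(X),\ \|T\|=1\}$, with the convention $n(\{0\})=1$. A directed set is a nonempty set $I$ with a partial order $\leq$ such that for all $i,j\in I$ there is $k\in I$ with $i\leq k$ and $j\leq k$. The family is increasing if $Z_i\subseteq Z_j$ whenever $i\leq j$. A closed subspace is one-complemented if it is the range of a linear projection on $Z$ of norm one (the zero subspace being allowed via the zero projection). For a net of real numbers, $\limsup_{i\in I}c_i=\inf_{i\in I}\sup_{j\geq i}c_j$. *)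

theory Defs
  imports "HOL-Analysis.Analysis"
begin

text \<open>
  The scalar field is the field of real or of complex numbers. The class below has, up to
  isometric isomorphism, exactly these two members: a multiplicative norm that extends the
  absolute value of the reals is unique on the complex numbers.
\<close>

class real_or_complex = real_normed_field +
  assumes real_or_complex:
    "(\<forall>x. \<exists>a. x = a *\<^sub>R 1) \<or>
     (\<exists>i. i * i = - 1 \<and> (\<forall>x. \<exists>a b. x = a *\<^sub>R 1 + b *\<^sub>R i))"

instance real :: real_or_complex
  by standard auto

instance complex :: real_or_complex
proof
  have "x = Re x *\<^sub>R 1 + Im x *\<^sub>R \<i>" for x :: complex
    by (simp add: complex_eq_iff)
  then show "(\<forall>x::complex. \<exists>a. x = a *\<^sub>R 1) \<or>
     (\<exists>i::complex. i * i = - 1 \<and> (\<forall>x. \<exists>a b. x = a *\<^sub>R 1 + b *\<^sub>R i))"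
    using i_squared by blast
qed

text \<open>
  The norm and the topology come from the type class, the scalar multiplication is an explicit
  parameter. A Banach space over the scalars is a type of class \<^class>\<open>banach\<close> with such a
  parameter.
\<close>

locale normed_space_over = vector_space scale
  for scale :: "'k::real_or_complex \<Rightarrow> 'z::real_normed_vector \<Rightarrow> 'z" +
  assumes norm_scale: "norm (scale c x) = norm c * norm x"
    and scale_of_real: "scale (of_real r) x = r *\<^sub>R x"

lemma normed_space_over_scaleR:
  "normed_space_over ((*\<^sub>R) :: real \<Rightarrow> 'z::real_normed_vector \<Rightarrow> 'z)"
  by unfold_locales (auto simp: algebra_simps)

lemma normed_space_over_times:
  "normed_space_over ((*) :: 'k::real_or_complex \<Rightarrow> 'k \<Rightarrow> 'k)"
  by unfold_locales (auto simp: algebra_simps norm_mult scaleR_conv_of_real)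

text \<open>
  Maps on a subspace \<open>X\<close> are represented by total functions; only their values on \<open>X\<close> matter
  in all definitions below.
\<close>

definition bounded_linear_on ::
  "('k::real_or_complex \<Rightarrow> 'z::real_normed_vector \<Rightarrow> 'z) \<Rightarrow>
   ('k \<Rightarrow> 'w::real_normed_vector \<Rightarrow> 'w) \<Rightarrow> 'z set \<Rightarrow> ('z \<Rightarrow> 'w) \<Rightarrow> bool"
  where "bounded_linear_on s t X f \<longleftrightarrow>
    (\<forall>x\<in>X. \<forall>y\<in>X. f (x + y) = f x + f y) \<and>
    (\<forall>c. \<forall>x\<in>X. f (s c x) = t c (f x)) \<and>
    (\<exists>K. \<forall>x\<in>X. norm (f x) \<le> K * norm x)"

definition onorm_on :: "'z::real_normed_vector set \<Rightarrow> ('z \<Rightarrow> 'w::real_normed_vector) \<Rightarrow> real"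
  where "onorm_on X f = (SUP x\<in>{x\<in>X. norm x \<le> 1}. norm (f x))"

definition operators ::
  "('k::real_or_complex \<Rightarrow> 'z::real_normed_vector \<Rightarrow> 'z) \<Rightarrow> 'z set \<Rightarrow> ('z \<Rightarrow> 'z) set"
  where "operators s X = {T. bounded_linear_on s s X T \<and> T ` X \<subseteq> X}"

definition dual ::
  "('k::real_or_complex \<Rightarrow> 'z::real_normed_vector \<Rightarrow> 'z) \<Rightarrow> 'z set \<Rightarrow> ('z \<Rightarrow> 'k) set"
  where "dual s X = {f. bounded_linear_on s (*) X f}"

definition state_pairs ::
  "('k::real_or_complex \<Rightarrow> 'z::real_normed_vector \<Rightarrow> 'z) \<Rightarrow> 'z set \<Rightarrow> ('z \<times> ('z \<Rightarrow> 'k)) set"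
  where "state_pairs s X =
    {(x, f). x \<in> X \<and> norm x = 1 \<and> f \<in> dual s X \<and> onorm_on X f = 1 \<and> f x = 1}"

text \<open>
  The numerical radius and the numerical index are taken in \<^typ>\<open>ennreal\<close>, so that all suprema
  and infima exist without side conditions. The index always lies between 0 and 1.
\<close>

definition numerical_radius ::
  "('k::real_or_complex \<Rightarrow> 'z::real_normed_vector \<Rightarrow> 'z) \<Rightarrow> 'z set \<Rightarrow> ('z \<Rightarrow> 'z) \<Rightarrow> ennreal"
  where "numerical_radius s X T = (SUP (x, f)\<in>state_pairs s X. ennreal (norm (f (T x))))"

definition numerical_index ::
  "('k::real_or_complex \<Rightarrow> 'z::real_normed_vector \<Rightarrow> 'z) \<Rightarrow> 'z set \<Rightarrow> ennreal"
  where "numerical_index s X =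
    (if X = {0} then 1 else INF T\<in>{T \<in> operators s X. onorm_on X T = 1}. numerical_radius s X T)"

lemma numerical_index_le_1:
  assumes "normed_space_over s" "module.subspace s X"
  shows "numerical_index s X \<le> 1"
proof (cases "X = {0}")
  case False
  interpret normed_space_over s by fact
  have "0 \<in> X" using assms(2) subspace_0 by blast
  with False obtain x where x: "x \<in> X" "x \<noteq> 0" by blast
  define u where "u = s (of_real (1 / norm x)) x"
  have u: "u \<in> X" "norm u = 1"
    using x assms(2) by (auto simp: u_def subspace_scale norm_scale norm_divide)
  have "onorm_on X (\<lambda>x. x) = 1"
    unfolding onorm_on_def using u by (intro cSup_eq_maximum) force+
  moreover have "(\<lambda>x. x) \<in> operators s X"
    by (auto simp: operators_def bounded_linear_on_def intro: exI[of _ 1])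
  moreover have "numerical_radius s X (\<lambda>x. x) \<le> 1"
    unfolding numerical_radius_def by (rule SUP_least) (auto simp: state_pairs_def)
  ultimately show ?thesis
    using False unfolding numerical_index_def by (auto intro: INF_lower2)
qed (simp add: numerical_index_def)

definition one_complemented ::
  "('k::real_or_complex \<Rightarrow> 'z::real_normed_vector \<Rightarrow> 'z) \<Rightarrow> 'z set \<Rightarrow> bool"
  where "one_complemented s Y \<longleftrightarrow>
    Y = {0} \<or>
    (\<exists>P \<in> operators s UNIV. P \<circ> P = P \<and> onorm_on UNIV P = 1 \<and> range P = Y)"

definition directed_set :: "'i set \<Rightarrow> 'i rel \<Rightarrow> bool"
  where "directed_set I r \<longleftrightarrow>
    I \<noteq> {} \<and> partial_order_on I r \<and> (\<forall>i\<in>I. \<forall>j\<in>I. \<exists>k\<in>I. (i, k) \<in> r \<and> (j, k) \<in> r)"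

definition net_limsup :: "'i set \<Rightarrow> 'i rel \<Rightarrow> ('i \<Rightarrow> ennreal) \<Rightarrow> ennreal"
  where "net_limsup I r c = (INF i\<in>I. SUP j\<in>{j\<in>I. (i, j) \<in> r}. c j)"

end

theory Submission imports Defs begin

text \<open>
  Compressing an operator to a one-complemented subspace does not increase its numerical radius,
  and compressing it to a large member of the family almost preserves its norm.

  Let \<open>P\<close> be a norm-one projection onto \<open>Y\<close>. If \<open>(y, f)\<close> is a state pair of \<open>Y\<close>, then
  \<open>(y, f \<circ> P)\<close> is one of the whole space, so the numerical radius of \<open>P \<circ> T\<close> on \<open>Y\<close> is at most
  that of \<open>T\<close> (\<open>numerical_radius_compression_le\<close>): the projection extends functionals from \<open>Y\<close> without
  increase of norm.

  Let \<open>T\<close> have norm one and let \<open>c < 1\<close>. The condition \<open>norm (T x) > c * norm x\<close> defines a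
  nonempty open set, hence holds for some \<open>x\<close> in the dense union of the subspaces. Once \<open>Y\<close>
  contains \<open>x\<close> and a good approximation of \<open>T x\<close>, the vector \<open>P (T x)\<close> is close to \<open>T x\<close>, and
  the norm of \<open>P \<circ> T\<close> on \<open>Y\<close> is at least \<open>c\<close>. The definition of the index, made homogeneous
  (\<open>numerical_index_mult_onorm_on_le\<close>), now bounds \<open>c\<close> times the index of \<open>Y\<close> by the numerical
  radius of \<open>T\<close>. This holds for every sufficiently late member of the family, so \<open>c\<close> times the
  upper limit is bounded by the same number; let \<open>c\<close> tend to \<open>1\<close>.
\<close>

section \<open>The operator norm on a subspace\<close>

context normed_space_over
begin

lemma bounded_linear_on_zero:
  assumes "bounded_linear_on scale t X f" "vector_space t" "subspace X"
  shows "f 0 = 0"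
proof -
  interpret t: vector_space t by fact
  have "f (scale 0 0) = t 0 (f 0)"
    using assms subspace_0 unfolding bounded_linear_on_def by blast
  then show ?thesis by simp
qed

lemma bdd_above_norm_image:
  assumes "bounded_linear_on scale t X f"
  shows "bdd_above ((\<lambda>x. norm (f x)) ` {x\<in>X. norm x \<le> 1})"
proof -
  from assms obtain K where K: "\<And>x. x \<in> X \<Longrightarrow> norm (f x) \<le> K * norm x"
    unfolding bounded_linear_on_def by blast
  have "norm (f x) \<le> \<bar>K\<bar>" if "x \<in> X" "norm x \<le> 1" for x
  proof -
    have "norm (f x) \<le> K * norm x" using K that by blast
    also have "\<dots> \<le> \<bar>K\<bar> * norm x" by (simp add: mult_right_mono)
    also have "\<dots> \<le> \<bar>K\<bar>" using that by (simp add: mult_left_le)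
    finally show ?thesis .
  qed
  then show ?thesis by (auto intro!: bdd_aboveI)
qed

lemma norm_le_onorm_on:
  assumes f: "bounded_linear_on scale t X f" and t: "normed_space_over t"
    and X: "subspace X" and x: "x \<in> X"
  shows "norm (f x) \<le> onorm_on X f * norm x"
proof (cases "x = 0")
  case True
  then show ?thesis
    using bounded_linear_on_zero[OF f _ X] t by (simp add: normed_space_over_def)
next
  case False
  interpret t: normed_space_over t by fact
  define u where "u = scale (of_real (1 / norm x)) x"
  have u: "u \<in> X" "norm u \<le> 1"
    using x X False by (auto simp: u_def subspace_scale norm_scale norm_divide)
  have "norm (f u) = norm (f x) / norm x"
    using f x by (simp add: u_def bounded_linear_on_def t.norm_scale norm_divide)
  moreover have "norm (f u) \<le> onorm_on X f"
    unfolding onorm_on_def using bdd_above_norm_image[OF f] u by (auto intro: cSUP_upper)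
  ultimately have "norm (f x) / norm x \<le> onorm_on X f" by simp
  then show ?thesis using False by (simp add: divide_le_eq)
qed

lemma onorm_on_nonneg:
  assumes "bounded_linear_on scale t X f" "subspace X"
  shows "0 \<le> onorm_on X f"
proof -
  have "norm (f 0) \<le> onorm_on X f"
    unfolding onorm_on_def
    using bdd_above_norm_image[OF assms(1)] subspace_0[OF assms(2)] by (auto intro: cSUP_upper)
  then show ?thesis using norm_ge_zero order_trans by blast
qed

section \<open>Homogeneity of the numerical radius\<close>

text \<open>
  Both sides are homogeneous in \<open>S\<close>, so dividing \<open>S\<close> by its norm reduces the inequality to the
  definition of the index.
\<close>

lemma numerical_index_mult_onorm_on_le:
  assumes X: "subspace X" and S: "S \<in> operators scale X"
  shows "ennreal (onorm_on X S) * numerical_index scale X \<le> numerical_radius scale X S"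
proof (cases "onorm_on X S = 0")
  case False
  have bl: "bounded_linear_on scale scale X S" and SX: "S ` X \<subseteq> X"
    using S by (auto simp: operators_def)
  define a where "a = onorm_on X S"
  have a: "a > 0"
    using False onorm_on_nonneg[OF bl X] by (simp add: a_def)
  define R where "R x = scale (of_real (1 / a)) (S x)" for x
  have norm_R: "norm (R x) = norm (S x) / a" for x
    using a by (simp add: R_def norm_scale norm_divide)
  have nontriv: "X \<noteq> {0}"
  proof
    assume "X = {0}"
    moreover have "S 0 = 0"
      by (rule bounded_linear_on_zero[OF bl _ X]) unfold_locales
    ultimately have "(\<lambda>x. norm (S x)) ` {x\<in>X. norm x \<le> 1} = {0}" by auto
    then show False using False by (simp add: onorm_on_def)
  qed
  have "bounded_linear_on scale scale X R"
    unfolding bounded_linear_on_def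
  proof (intro conjI)
    show "\<forall>x\<in>X. \<forall>y\<in>X. R (x + y) = R x + R y" "\<forall>c. \<forall>x\<in>X. R (scale c x) = scale c (R x)"
      using bl by (auto simp: bounded_linear_on_def R_def scale_right_distrib mult.commute)
    obtain K where "\<And>x. x \<in> X \<Longrightarrow> norm (S x) \<le> K * norm x"
      using bl unfolding bounded_linear_on_def by blast
    then show "\<exists>K. \<forall>x\<in>X. norm (R x) \<le> K * norm x"
      using a by (intro exI[of _ "K / a"]) (auto simp: norm_R divide_right_mono)
  qed
  moreover have "R ` X \<subseteq> X"
    using SX X by (auto simp: R_def subspace_scale)
  ultimately have R_op: "R \<in> operators scale X" by (simp add: operators_def)
  have "onorm_on X R = 1"
  proof (rule antisym)
    have ne: "{x\<in>X. norm x \<le> 1} \<noteq> {}" using subspace_0[OF X] by force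
    have S_le: "norm (S x) \<le> a" if "x \<in> X" "norm x \<le> 1" for x
      unfolding a_def onorm_on_def using bdd_above_norm_image[OF bl] that
      by (auto intro: cSUP_upper)
    show "onorm_on X R \<le> 1"
      unfolding onorm_on_def using ne S_le a by (intro cSUP_least) (auto simp: norm_R)
    have "norm (S x) \<le> a * onorm_on X R" if "x \<in> X" "norm x \<le> 1" for x
    proof -
      have "norm (R x) \<le> onorm_on X R"
        unfolding onorm_on_def using bdd_above_norm_image R_op that
        by (auto intro!: cSUP_upper simp: operators_def)
      then show ?thesis using a by (simp add: norm_R field_simps)
    qed
    then have "a \<le> a * onorm_on X R"
      unfolding a_def onorm_on_def[of X S] using ne by (intro cSUP_least) auto
    then show "1 \<le> onorm_on X R" using a by simp
  qed
  then have "numerical_index scale X \<le> numerical_radius scale X R"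
    using nontriv R_op by (auto simp: numerical_index_def intro: INF_lower)
  then have "ennreal a * numerical_index scale X \<le> ennreal a * numerical_radius scale X R"
    by (rule mult_left_mono) simp
  also have "\<dots> = (SUP p\<in>state_pairs scale X. ennreal a * (case p of (x, f) \<Rightarrow> ennreal (norm (f (R x)))))"
    unfolding numerical_radius_def by (simp add: SUP_mult_left_ennreal)
  also have "\<dots> \<le> numerical_radius scale X S"
    unfolding numerical_radius_def
  proof (rule SUP_mono, clarify)
    fix x f assume p: "(x, f) \<in> state_pairs scale X"
    then have "S x \<in> X" using SX by (auto simp: state_pairs_def)
    then have "f (R x) = of_real (1 / a) * f (S x)"
      using p by (simp add: R_def state_pairs_def dual_def bounded_linear_on_def)
    then have "ennreal a * ennreal (norm (f (R x))) = ennreal (norm (f (S x)))"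
      using a by (simp add: norm_mult norm_divide flip: ennreal_mult)
    with p show "\<exists>q\<in>state_pairs scale X. ennreal a * ennreal (norm (f (R x)))
        \<le> (case q of (x, f) \<Rightarrow> ennreal (norm (f (S x))))"
      by force
  qed
  finally show ?thesis by (simp add: a_def)
qed simp

section \<open>Compression to a one-complemented subspace\<close>

lemma norm_one_projection_le:
  assumes "P \<in> operators scale UNIV" "onorm_on UNIV P = 1"
  shows "norm (P x) \<le> norm x"
proof -
  have "norm (P x) \<le> onorm_on UNIV P * norm x"
    using assms(1) normed_space_over_axioms
    by (intro norm_le_onorm_on) (auto simp: operators_def)
  then show ?thesis using assms(2) by simp
qed

text \<open>
  A functional of norm one on the range of \<open>P\<close> extends to \<open>f \<circ> P\<close> without increase of norm,
  and the extension takes the same value at \<open>y\<close> because \<open>P y = y\<close>.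
\<close>

lemma state_pairs_comp_projection:
  assumes P: "P \<in> operators scale UNIV" "P \<circ> P = P" "onorm_on UNIV P = 1" "range P = Y"
    and Y: "subspace Y" and p: "(y, f) \<in> state_pairs scale Y"
  shows "(y, f \<circ> P) \<in> state_pairs scale UNIV"
proof -
  have Pl: "P (x + x') = P x + P x'" "P (scale c x) = scale c (P x)" for x x' c
    using P(1) by (auto simp: operators_def bounded_linear_on_def)
  have PY: "P x \<in> Y" for x using P(4) by blast
  have f: "bounded_linear_on scale (*) Y f" "onorm_on Y f = 1"
    and y: "y \<in> Y" "norm y = 1" "f y = 1"
    using p by (auto simp: state_pairs_def dual_def)
  have Py: "P y = y"
    using y(1) P(2,4) by (metis comp_apply imageE)
  have le: "norm (f (P x)) \<le> norm x" for x
  proof -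
    have "norm (f (P x)) \<le> norm (P x)"
      using norm_le_onorm_on[OF f(1) normed_space_over_times Y PY, of x] f(2) by simp
    also have "\<dots> \<le> norm x" by (rule norm_one_projection_le[OF P(1,3)])
    finally show ?thesis .
  qed
  have "f \<circ> P \<in> dual scale UNIV"
    using f(1) PY le by (auto simp: dual_def bounded_linear_on_def Pl intro!: exI[of _ 1])
  moreover have "onorm_on UNIV (f \<circ> P) = 1"
    unfolding onorm_on_def
  proof (rule cSup_eq_maximum)
    show "1 \<in> (\<lambda>x. norm ((f \<circ> P) x)) ` {x\<in>UNIV. norm x \<le> 1}"
      using y Py by (intro image_eqI[of _ _ y]) auto
  qed (use le order_trans in auto)
  ultimately show ?thesis using y Py by (simp add: state_pairs_def)
qed

lemma numerical_radius_compression_le: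
  assumes P: "P \<in> operators scale UNIV" "P \<circ> P = P" "onorm_on UNIV P = 1" "range P = Y"
    and Y: "subspace Y"
  shows "numerical_radius scale Y (P \<circ> T) \<le> numerical_radius scale UNIV T"
  unfolding numerical_radius_def
proof (rule SUP_mono, clarify)
  fix y f assume "(y, f) \<in> state_pairs scale Y"
  from state_pairs_comp_projection[OF P Y this]
  show "\<exists>q\<in>state_pairs scale UNIV. ennreal (norm (f ((P \<circ> T) y)))
      \<le> (case q of (x, g) \<Rightarrow> ennreal (norm (g (T x))))"
    by (intro bexI[of _ "(y, f \<circ> P)"]) auto
qed

lemma compression_in_operators:
  assumes P: "P \<in> operators scale UNIV" "onorm_on UNIV P = 1" "range P = Y"
    and T: "T \<in> operators scale UNIV"
  shows "P \<circ> T \<in> operators scale Y"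
proof -
  obtain K where "\<And>x. norm (T x) \<le> K * norm x"
    using T by (auto simp: operators_def bounded_linear_on_def)
  then have "norm (P (T x)) \<le> K * norm x" for x
    using norm_one_projection_le[OF P(1,2)] order_trans by blast
  then show ?thesis
    using P T by (auto simp: operators_def bounded_linear_on_def)
qed

text \<open>
  The quantitative core. Both the error of approximating \<open>T x\<close> by \<open>y\<close> and its image under \<open>P\<close>
  cost at most \<open>norm (T x - y)\<close>, whence the factor \<open>2\<close>.
\<close>

lemma mult_numerical_index_le_numerical_radius:
  assumes Y: "subspace Y" "one_complemented scale Y" and T: "T \<in> operators scale UNIV"
    and x: "x \<in> Y" "x \<noteq> 0" and y: "y \<in> Y"
    and close: "c * norm x + 2 * norm (T x - y) \<le> norm (T x)"
  shows "ennreal c * numerical_index scale Y \<le> numerical_radius scale UNIV T"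
proof -
  obtain P where P: "P \<in> operators scale UNIV" "P \<circ> P = P" "onorm_on UNIV P = 1" "range P = Y"
    using Y(2) x by (auto simp: one_complemented_def)
  have "P y = y" using y P(2,4) by (metis comp_apply imageE)
  moreover have "P (T x) = P (T x - y) + P y"
    using P(1) by (simp add: operators_def bounded_linear_on_def flip: diff_add_eq)
       (metis diff_add_cancel)
  ultimately have "norm y \<le> norm (P (T x)) + norm (P (T x - y))"
    by (metis add_diff_cancel_left' norm_triangle_ineq4)
  moreover have "norm (P (T x - y)) \<le> norm (T x - y)"
    by (rule norm_one_projection_le[OF P(1,3)])
  moreover have "norm (T x) \<le> norm y + norm (T x - y)"
    by (metis add.commute diff_add_cancel norm_triangle_ineq)
  ultimately have "c * norm x \<le> norm (P (T x))" using close by linarith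
  also have PT: "P \<circ> T \<in> operators scale Y"
    by (rule compression_in_operators[OF P(1,3,4) T])
  then have "norm (P (T x)) \<le> onorm_on Y (P \<circ> T) * norm x"
    using norm_le_onorm_on[of scale Y "P \<circ> T" x] normed_space_over_axioms Y(1) x(1)
    by (simp add: operators_def)
  finally have "c \<le> onorm_on Y (P \<circ> T)" using x(2) by simp
  then have "ennreal c * numerical_index scale Y
      \<le> ennreal (onorm_on Y (P \<circ> T)) * numerical_index scale Y"
    by (intro mult_right_mono ennreal_leI) auto
  also have "\<dots> \<le> numerical_radius scale Y (P \<circ> T)"
    by (rule numerical_index_mult_onorm_on_le[OF Y(1) PT])
  also have "\<dots> \<le> numerical_radius scale UNIV T"
    by (rule numerical_radius_compression_le[OF P Y(1)])
  finally show ?thesis .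
qed

lemma operators_UNIV_bounded_linear:
  assumes "T \<in> operators scale UNIV"
  shows "bounded_linear T"
proof -
  obtain K where "\<And>x. norm (T x) \<le> K * norm x"
    using assms by (auto simp: operators_def bounded_linear_on_def)
  moreover have "T (a *\<^sub>R x) = a *\<^sub>R T x" for a x
    using assms by (simp add: operators_def bounded_linear_on_def flip: scale_of_real)
  ultimately show ?thesis
    using assms
    by (intro bounded_linear_intro[of _ K])
      (auto simp: operators_def bounded_linear_on_def mult.commute)
qed

text \<open>
  A strict inequality that is homogeneous in \<open>x\<close> defines an open set without reference to the
  unit ball, so a point of the dense set \<open>D\<close> need not be rescaled to satisfy it.
\<close>

lemma dense_almost_norming:
  assumes T: "T \<in> operators scale UNIV" "onorm_on UNIV T = 1"
    and D: "closure D = UNIV" and c: "0 \<le> c" "c < 1"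
  obtains x where "x \<in> D" "c * norm x < norm (T x)"
proof -
  let ?U = "{x. c * norm x < norm (T x)}"
  have "c < (SUP x\<in>{x\<in>UNIV. norm x \<le> 1}. norm (T x))"
    using T(2) c by (simp add: onorm_on_def)
  moreover have "{x\<in>(UNIV :: 'z set). norm x \<le> 1} \<noteq> {}"
    by (auto intro: exI[of _ 0])
  moreover have "bdd_above ((\<lambda>x. norm (T x)) ` {x\<in>UNIV. norm x \<le> 1})"
    using T(1) by (intro bdd_above_norm_image) (simp add: operators_def)
  ultimately obtain x where "norm x \<le> 1" "c < norm (T x)"
    by (auto simp: less_cSUP_iff)
  then have "x \<in> ?U" using c mult_left_le[of "norm x" c] by simp
  moreover have "open ?U"
    using bounded_linear.continuous_on[OF operators_UNIV_bounded_linear[OF T(1)] continuous_on_id]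
    by (intro open_Collect_less continuous_intros)
  ultimately have "D \<inter> ?U \<noteq> {}"
    using D open_Int_closure_eq_empty[of ?U D] by blast
  then show thesis using that by blast
qed

end

section \<open>Upper limits along a directed set\<close>

lemma net_limsup_le_if_eventually_le:
  assumes "k \<in> I" "\<And>j. j \<in> I \<Longrightarrow> (k, j) \<in> r \<Longrightarrow> c j \<le> b"
  shows "net_limsup I r c \<le> b"
  unfolding net_limsup_def using assms by (intro INF_lower2[of k]) (auto intro: SUP_least)

lemma mult_net_limsup_le_if_eventually_le:
  assumes "k \<in> I" "\<And>j. j \<in> I \<Longrightarrow> (k, j) \<in> r \<Longrightarrow> ennreal a * c j \<le> b"
  shows "ennreal a * net_limsup I r c \<le> b"
proof -
  have "ennreal a * net_limsup I r c \<le> ennreal a * (SUP j\<in>{j\<in>I. (k, j) \<in> r}. c j)"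
    unfolding net_limsup_def using assms(1) by (intro mult_left_mono INF_lower) auto
  also have "\<dots> = (SUP j\<in>{j\<in>I. (k, j) \<in> r}. ennreal a * c j)"
    by (simp add: SUP_mult_left_ennreal)
  also have "\<dots> \<le> b" using assms(2) by (auto intro: SUP_least)
  finally show ?thesis .
qed

lemma ennreal_le_mult_one_interval:
  fixes l v :: ennreal
  assumes "l < top" "\<And>c. 0 < c \<Longrightarrow> c < 1 \<Longrightarrow> ennreal c * l \<le> v"
  shows "l \<le> v"
proof (cases v)
  case (real b)
  obtain a where a: "l = ennreal a" "0 \<le> a" using assms(1) by (cases l) auto
  have "c * a \<le> b" if "0 < c" "c < 1" for c
    using assms(2)[OF that] that a real by (simp flip: ennreal_mult)
  then have "a \<le> b" by (rule field_le_mult_one_interval)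
  then show ?thesis using a real by (simp add: ennreal_leI)
qed simp

section \<open>The numerical index of the closure of the union\<close>

theorem theorem5p1:
  fixes scale :: "'k::real_or_complex \<Rightarrow> 'z::banach \<Rightarrow> 'z"
    and I :: "'i set" and r :: "'i rel" and Z :: "'i \<Rightarrow> 'z set"
  assumes "normed_space_over scale"
    and "directed_set I r"
    and "\<And>i. i \<in> I \<Longrightarrow> module.subspace scale (Z i)"
    and "\<And>i. i \<in> I \<Longrightarrow> closed (Z i)"
    and "\<And>i. i \<in> I \<Longrightarrow> one_complemented scale (Z i)"
    and "\<And>i j. (i, j) \<in> r \<Longrightarrow> Z i \<subseteq> Z j"
    and "closure (\<Union>i\<in>I. Z i) = UNIV"
  shows "numerical_index scale UNIV \<ge> net_limsup I r (\<lambda>i. numerical_index scale (Z i))"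
proof -
  interpret normed_space_over scale by fact
  let ?L = "net_limsup I r (\<lambda>i. numerical_index scale (Z i))"
  obtain i0 where "i0 \<in> I" using assms(2) by (auto simp: directed_set_def)
  then have L1: "?L \<le> 1"
    using numerical_index_le_1[OF assms(1,3)] by (rule net_limsup_le_if_eventually_le)
  have "?L \<le> numerical_radius scale UNIV T"
    if T: "T \<in> operators scale UNIV" "onorm_on UNIV T = 1" for T
  proof (rule ennreal_le_mult_one_interval)
    show "?L < top" using L1 by (rule le_less_trans) simp
    fix c :: real assume c: "0 < c" "c < 1"
    obtain x where x: "x \<in> (\<Union>i\<in>I. Z i)" "c * norm x < norm (T x)"
      using dense_almost_norming[OF T assms(7)] c by (metis less_imp_le)
    \<comment> \<open>the largest distance from \<open>T x\<close> to the subspace that the compression tolerates\<close>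
    define d where "d = (norm (T x) - c * norm x) / 2"
    have "d > 0" using x(2) by (simp add: d_def)
    moreover have "T x \<in> closure (\<Union>i\<in>I. Z i)" using assms(7) by simp
    ultimately obtain y where y: "y \<in> (\<Union>i\<in>I. Z i)" "dist y (T x) < d"
      by (meson closure_approachable)
    have close: "c * norm x + 2 * norm (T x - y) \<le> norm (T x)"
      using y(2) by (simp add: d_def dist_norm norm_minus_commute field_simps)
    have "T 0 = 0"
      using operators_UNIV_bounded_linear[OF T(1)] by (rule linear_simps)
    then have "x \<noteq> 0" using x(2) by auto
    obtain i j where "i \<in> I" "x \<in> Z i" "j \<in> I" "y \<in> Z j" using x y by blast
    moreover then obtain k where k: "k \<in> I" "(i, k) \<in> r" "(j, k) \<in> r"
      using assms(2) unfolding directed_set_def by blast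
    ultimately have xy: "x \<in> Z k" "y \<in> Z k" using assms(6) by blast+
    show "ennreal c * ?L \<le> numerical_radius scale UNIV T"
    proof (rule mult_net_limsup_le_if_eventually_le[OF k(1)])
      fix m assume m: "m \<in> I" "(k, m) \<in> r"
      then have "x \<in> Z m" "y \<in> Z m" using xy assms(6) by blast+
      then show "ennreal c * numerical_index scale (Z m) \<le> numerical_radius scale UNIV T"
        using mult_numerical_index_le_numerical_radius[OF assms(3,5) T(1)] m(1) \<open>x \<noteq> 0\<close> close
        by blast
    qed
  qed
  \<comment> \<open>The trivial space has index \<open>1\<close> by convention; there \<open>?L \<le> 1\<close> is the whole claim.\<close>
  then show ?thesis using L1 by (auto simp: numerical_index_def intro: INF_greatest)
qed

end
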